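(* Let $X$ be a Banach space, $Y$ a Hilbert space, $A:X\to Y$ a bounded linear operator, and $\mathcal R:X\to(-\infty,\infty]$ a proper, lower semi-continuous, strongly convex function with modulus of convexity $\sigma>0$. Let $y\in Y$ be such that $Ax=y$ has a solution in $\mathrm{dom}(\mathcal R)$, and let $x^\dagger$ be the unique solution of $\min\{\mathcal R(x): x\in X,\ Ax=y\}$. Let $L:=\|A\|^2/(2\sigma)$ and $0<\gamma\le 1/L$. Assume that there are a function $\mathcal E^\dagger:\mathrm{dom}(\mathcal R)\to[0,\infty)$ with $\mathcal E^\dagger(x^\dagger)=0$ and constants $0<q\le 1$, $M>0$ such that $$\mathcal E^\dagger(x)\le \mathcal R(x)-\mathcal R(x^\dagger)+M\|Ax-y\|^q\qquad\text{for all } x\in\mathrm{dom}(\mathcal R).$$ For $\delta>0$ and $y^\delta\in Y$ with $\|y^\delta-y\|\le\delta$, let $(x_n,\lambda_n)_{n\ge0}$ be generated by the dual gradient method with $\lambda_0=0$: $$x_n=\arg\min_{x\in X}\{\mathcal R(x)-\langle\lambda_n,Ax-y^\delta\rangle\},\qquad \lambda_{n+1}=\lambda_n-\gamma(Ax_n-y^\delta).$$ Then there is a constant $C>0$ independent of $n$ and $\delta$ such that $$\mathcal E^\dagger(x_n)\le C\left(n^{-\frac{q}{2-q}}+\delta^q+n^{\frac{1-q}{2-q}}\delta+n\delta^2\right)\qquad\text{for all } n\ge1.$$ Consequently, choosing an integer $n_\delta$ with $n_\delta\sim\delta^{q-2}$, one has $\mathcal E^\dagger(x_{n_\delta})=O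(\delta^q)$.
   Context: All vector spaces are real, and all norms are written $\|\cdot\|$. $X^*$ is the dual of $X$, and $\langle\cdot,\cdot\rangle$ denotes both the duality pairing and the inner product of $Y$. $\mathrm{dom}(\mathcal R)=\{x\in X:\mathcal R(x)<\infty\}$; $\mathcal R$ is proper if $\mathrm{dom}(\mathcal R)\neq\emptyset$. $\mathcal R$ is strongly convex if there is $\sigma>0$ with $\mathcal R(t\bar x+(1-t)x)+\sigma t(1-t)\|\bar x-x\|^2\le t\mathcal R(\bar x)+(1-t)\mathcal R(x)$ for all $\bar x,x\in\mathrm{dom}(\mathcal R)$, $t\in[0,1]$; the largest such $\sigma$ is the modulus of convexity. Under the stated assumptions the constrained problem defining $x^\dagger$ and each minimization problem defining $x_n$ have a unique minimizer. The iterates depend on $y^\delta$ (and hence on $\delta$). $n_\delta\sim\delta^{q-2}$ means that $n_\delta$ lies between two fixed positive multiples of $\delta^{q-2}$, and $O(\cdot)$ is understood as $\delta\to0$, with constants independent of $\delta$ and of the particular $y^\delta$. *)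

theory Defs
  imports "HOL-Analysis.Analysis"
begin

definition effective_domain :: "('a \<Rightarrow> ereal) \<Rightarrow> 'a set" where
  "effective_domain R = {x. R x < \<infinity>}"

definition lower_semicontinuous :: "('a::topological_space \<Rightarrow> ereal) \<Rightarrow> bool" where
  "lower_semicontinuous R \<longleftrightarrow> (\<forall>x. R x \<le> Liminf (at x) R)"

(* The quadratic term is s * t * (1 - t) * norm^2, without the factor 1/2 used by some authors. *)
definition strongly_convex_with :: "real \<Rightarrow> ('a::real_normed_vector \<Rightarrow> ereal) \<Rightarrow> bool" where
  "strongly_convex_with s R \<longleftrightarrow>
     (\<forall>u\<in>effective_domain R. \<forall>x\<in>effective_domain R. \<forall>t\<in>{0..1}.
        R (t *\<^sub>R u + (1 - t) *\<^sub>R x) + ereal (s * t * (1 - t) * (norm (u - x))\<^sup>2)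
          \<le> ereal t * R u + ereal (1 - t) * R x)"

definition strongly_convex :: "('a::real_normed_vector \<Rightarrow> ereal) \<Rightarrow> bool" where
  "strongly_convex R \<longleftrightarrow> (\<exists>s>0. strongly_convex_with s R)"

(* The largest admissible constant. For a proper R without the value -\<infinity> it is attained whenever
   it is finite (convexity_modulus_attained); it is \<infinity> only if the effective domain is a single
   point (convexity_modulus_infinite), where every constant is admissible. *)
definition convexity_modulus :: "('a::real_normed_vector \<Rightarrow> ereal) \<Rightarrow> ereal" where
  "convexity_modulus R = Sup {ereal s | s. s > 0 \<and> strongly_convex_with s R}"

(* x n minimizes over the whole space; the sequence lam starts at 0. *)
definition dual_gradient_iterates ::
  "('a::real_normed_vector \<Rightarrow> ereal) \<Rightarrow> ('a \<Rightarrow> 'b::real_inner) \<Rightarrow> real \<Rightarrow> 'b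
     \<Rightarrow> (nat \<Rightarrow> 'a) \<Rightarrow> (nat \<Rightarrow> 'b) \<Rightarrow> bool" where
  "dual_gradient_iterates R A \<gamma> yd x lam \<longleftrightarrow>
     lam 0 = 0 \<and>
     (\<forall>n. is_arg_min (\<lambda>z. R z - ereal (lam n \<bullet> (A z - yd))) (\<lambda>z. True) (x n)) \<and>
     (\<forall>n. lam (Suc n) = lam n - \<gamma> *\<^sub>R (A (x n) - yd))"

lemma strongly_convex_with_realD:
  assumes R: "\<And>x. R x \<noteq> -\<infinity>" and S: "strongly_convex_with s R"
    and u: "R u = ereal a" and x: "R x = ereal b" and t: "t \<in> {0..1}"
  obtains c where "R (t *\<^sub>R u + (1 - t) *\<^sub>R x) = ereal c"
    "c + s * t * (1 - t) * (norm (u - x))\<^sup>2 \<le> t * a + (1 - t) * b"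
proof -
  have "R (t *\<^sub>R u + (1 - t) *\<^sub>R x) + ereal (s * t * (1 - t) * (norm (u - x))\<^sup>2)
          \<le> ereal t * R u + ereal (1 - t) * R x"
    using S[unfolded strongly_convex_with_def, rule_format, of u x t] u x t
    by (simp add: effective_domain_def)
  then show thesis
    using R[of "t *\<^sub>R u + (1 - t) *\<^sub>R x"] u x that
    by (cases "R (t *\<^sub>R u + (1 - t) *\<^sub>R x)") auto
qed

lemma effective_domainE:
  assumes "\<And>x. R x \<noteq> -\<infinity>" "u \<in> effective_domain R"
  obtains a where "R u = ereal a"
  using assms by (cases "R u") (auto simp: effective_domain_def)

lemma convexity_modulus_attained:
  assumes R: "\<And>x. R x \<noteq> -\<infinity>" and sc: "strongly_convex R"
    and fin: "convexity_modulus R = ereal m"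
  shows "m > 0" "strongly_convex_with m R"
proof -
  let ?P = "\<lambda>s. s > 0 \<and> strongly_convex_with s R"
  obtain s0 where s0: "?P s0" using sc by (auto simp: strongly_convex_def)
  have "ereal s0 \<le> convexity_modulus R"
    unfolding convexity_modulus_def by (rule Sup_upper) (use s0 in auto)
  then show "m > 0" using s0 fin by simp
  show "strongly_convex_with m R"
    unfolding strongly_convex_with_def
  proof (intro ballI)
    fix u x and t :: real
    assume u: "u \<in> effective_domain R" and x: "x \<in> effective_domain R" and t: "t \<in> {0..1}"
    obtain a where a: "R u = ereal a" using effective_domainE[OF R u] by blast
    obtain b where b: "R x = ereal b" using effective_domainE[OF R x] by blast
    obtain c where c: "R (t *\<^sub>R u + (1 - t) *\<^sub>R x) = ereal c"
      using strongly_convex_with_realD[OF R conjunct2[OF s0] a b t] by blast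
    define w where "w = t * (1 - t) * (norm (u - x))\<^sup>2"
    have w: "w \<ge> 0" using t by (simp add: w_def)
    have le: "c + s * w \<le> t * a + (1 - t) * b" if P: "?P s" for s
    proof -
      obtain c' where "R (t *\<^sub>R u + (1 - t) *\<^sub>R x) = ereal c'"
        "c' + s * t * (1 - t) * (norm (u - x))\<^sup>2 \<le> t * a + (1 - t) * b"
        using strongly_convex_with_realD[OF R conjunct2[OF P] a b t] by blast
      then show ?thesis using c by (simp add: w_def algebra_simps)
    qed
    have "c + m * w \<le> t * a + (1 - t) * b"
    proof (rule field_le_epsilon)
      fix e :: real assume e: "e > 0"
      define d where "d = e / (w + 1)"
      have d: "d > 0" using e w by (simp add: d_def)
      have "ereal (m - d) < Sup {ereal s | s. ?P s}"
        using fin d by (simp add: convexity_modulus_def)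
      then obtain s where s: "?P s" "m - d < s"
        by (auto simp: less_Sup_iff)
      have "m * w \<le> s * w + d * w"
        using mult_right_mono[of m "s + d" w] s w by (simp add: algebra_simps)
      moreover have "d * w \<le> e" using w e by (simp add: d_def field_simps)
      ultimately show "c + m * w \<le> t * a + (1 - t) * b + e" using le[OF s(1)] by linarith
    qed
    then show "R (t *\<^sub>R u + (1 - t) *\<^sub>R x) + ereal (m * t * (1 - t) * (norm (u - x))\<^sup>2)
          \<le> ereal t * R u + ereal (1 - t) * R x"
      by (simp add: a b c w_def mult.assoc)
  qed
qed

lemma convexity_modulus_infinite:
  assumes R: "\<And>x. R x \<noteq> -\<infinity>" and inf: "convexity_modulus R = \<infinity>"
    and u: "u \<in> effective_domain R" and x: "x \<in> effective_domain R"
  shows "u = x"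
proof (rule ccontr)
  assume ne: "u \<noteq> x"
  let ?P = "\<lambda>s. s > 0 \<and> strongly_convex_with s R"
  obtain a where a: "R u = ereal a" using effective_domainE[OF R u] by blast
  obtain b where b: "R x = ereal b" using effective_domainE[OF R x] by blast
  define r where "r = real_of_ereal (R ((1/2) *\<^sub>R u + (1/2) *\<^sub>R x))"
  define w where "w = (norm (u - x))\<^sup>2 / 4"
  have w: "w > 0" using ne by (simp add: w_def)
  have le: "r + s * w \<le> a / 2 + b / 2" if P: "?P s" for s
  proof -
    obtain c where "R ((1/2) *\<^sub>R u + (1 - 1/2) *\<^sub>R x) = ereal c"
      "c + s * (1/2) * (1 - 1/2) * (norm (u - x))\<^sup>2 \<le> (1/2) * a + (1 - 1/2) * b"
      by (rule strongly_convex_with_realD[OF R conjunct2[OF P] a b, of "1/2"]) auto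
    then show ?thesis by (simp add: r_def w_def)
  qed
  have "ereal ((a / 2 + b / 2 - r) / w) < Sup {ereal s | s. ?P s}"
    using inf by (simp add: convexity_modulus_def)
  then obtain s where s: "?P s" "(a / 2 + b / 2 - r) / w < s"
    by (auto simp: less_Sup_iff)
  then show False using le[OF s(1)] w by (simp add: field_simps)
qed

end

theory Submission
  imports Defs
begin

text \<open>
The method is gradient descent with step \<open>\<gamma>\<close> for the dual function, whose gradient at \<open>lam n\<close> is the
residual \<open>A (x n) - yd\<close>. Strong convexity of \<open>R\<close> makes this gradient Lipschitz, and \<open>\<gamma> \<le> 1 / L\<close> is the
classical step size condition.

Since \<open>x n\<close> minimizes the Lagrangian for \<open>lam n\<close>, comparison with \<open>xdag\<close> gives
\<open>R (x n) - R xdag \<le> norm (lam n) * norm (A (x n) - y)\<close> (\<open>objective_gap\<close>). By the source inequality the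
error is thus at most \<open>norm (lam n) * norm (A (x n) - y) + M * norm (A (x n) - y) powr q\<close>, and everything
reduces to bounding the multipliers and the residuals.

Both bounds come from one energy estimate (\<open>dual_energy\<close>): the decrease of the dual values, their
convexity and the monotonicity of the residuals bound \<open>n * (dual_value n - D)\<close>,
\<open>norm (lam n - \<mu>) ^ 2\<close> and \<open>n ^ 2 * norm (residual n) ^ 2\<close>, suitably weighted, by
\<open>norm \<mu> ^ 2\<close>, where \<open>D\<close> is an upper bound for the dual function at an arbitrary comparison point \<open>\<mu>\<close>. The dual problem
need not have a solution. The comparison point is therefore an approximate one that depends on \<open>n\<close>: it
minimizes the dual function for exact data plus \<open>norm \<mu> ^ 2 / (2 * \<gamma> * (n + 1))\<close>. By duality with the quadratically penalized
primal problem, the source inequality controls the value of this minimum, which exceeds \<open>- R xdag\<close> by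
at most a constant times \<open>n powr (- (q / (2 - q)))\<close> (\<open>source_multiplier\<close>, with a penalized minimizer
from \<open>exists_minimizer\<close>). In the energy, noise enters only as \<open>n * norm (lam n - \<mu>) * \<delta>\<close>, which is
absorbed at the price of \<open>(n * \<delta>)\<^sup>2\<close> (\<open>noisy_energy\<close>).

With \<open>a = (1 - q) / (2 - q)\<close> this yields multipliers of order \<open>n powr a + n * \<delta>\<close> and residuals of order
\<open>n powr (a - 1) + \<delta>\<close> (\<open>iterate_bounds\<close>). Their product is of the order of the first, third and fourth
terms of the rate, and the power \<open>q\<close> of the residual is of the order of the first two. For \<open>n\<close> of order
\<open>\<delta> powr (q - 2)\<close> each of the four terms is of order \<open>\<delta> powr q\<close>.
\<close>

section \<open>Strongly convex functions and their minimizers\<close>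

text \<open>The passage to the limit \<open>t \<rightarrow> 0\<close> in every argument below that compares a minimizer
with the points at parameter \<open>t\<close> on a segment leaving it.\<close>

lemma nonneg_of_affine_nonneg:
  fixes a b :: real
  assumes "\<And>t. 0 < t \<Longrightarrow> t < 1 \<Longrightarrow> 0 \<le> a + t * b"
  shows "0 \<le> a"
proof (rule tendsto_lowerbound)
  show "((\<lambda>t. a + t * b) \<longlongrightarrow> a) (at_right 0)"
    by (auto intro!: tendsto_eq_intros)
  show "\<forall>\<^sub>F t in at_right 0. 0 \<le> a + t * b"
    unfolding eventually_at_right_field using assms by (intro exI[of _ 1]) auto
qed simp

lemma norm_convex_combination_sq:
  fixes a b :: "'a::real_inner"
  shows "(norm (t *\<^sub>R a + (1 - t) *\<^sub>R b))\<^sup>2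
    = t * (norm a)\<^sup>2 + (1 - t) * (norm b)\<^sup>2 - t * (1 - t) * (norm (a - b))\<^sup>2"
  unfolding power2_norm_eq_inner
  by (simp add: inner_simps inner_commute[of b a]) (simp add: algebra_simps)

text \<open>Extended-valued functions are replaced by a real function together with its domain \<open>S\<close>, so
that all estimates are plain real arithmetic. Strong convexity is then stable under adding a convex
function, in particular under tilting by a linear functional and under adding a quadratic penalty.\<close>

locale strongly_convex_function =
  fixes S :: "'x::real_normed_vector set" and f :: "'x \<Rightarrow> real" and s :: real
  assumes modulus_pos: "0 < s"
    and convex_domain: "convex S"
    and strong_convexity:
      "\<lbrakk>u \<in> S; v \<in> S; 0 \<le> t; t \<le> 1\<rbrakk> \<Longrightarrow>
        f (t *\<^sub>R u + (1 - t) *\<^sub>R v) + s * t * (1 - t) * (norm (u - v))\<^sup>2 \<le> t * f u + (1 - t) * f v"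
begin

lemma segment_mem: "\<lbrakk>u \<in> S; v \<in> S; 0 \<le> t; t \<le> 1\<rbrakk> \<Longrightarrow> t *\<^sub>R u + (1 - t) *\<^sub>R v \<in> S"
  using convex_domain by (simp add: convexD)

lemma convex_on_domain: "convex_on S f"
proof (rule convex_onI[OF _ convex_domain])
  fix t :: real and x y assume t: "0 < t" "t < 1" and xy: "x \<in> S" "y \<in> S"
  have "0 \<le> s * (1 - t) * t * (norm (y - x))\<^sup>2" 
    using t modulus_pos by simp
  with strong_convexity[OF xy(2,1), of t] t show "f ((1 - t) *\<^sub>R x + t *\<^sub>R y) \<le> (1 - t) * f x + t * f y"
    by (simp add: algebra_simps)
qed

lemma add_convex:
  assumes "convex_on S g"
  shows "strongly_convex_function S (\<lambda>z. f z + g z) s"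
proof
  fix u v :: 'x and t :: real
  assume uv: "u \<in> S" "v \<in> S" and t: "0 \<le> t" "t \<le> 1"
  have "g (t *\<^sub>R u + (1 - t) *\<^sub>R v) \<le> t * g u + (1 - t) * g v"
    using assms uv t by (simp add: convex_on_def)
  with strong_convexity[OF uv t]
  show "f (t *\<^sub>R u + (1 - t) *\<^sub>R v) + g (t *\<^sub>R u + (1 - t) *\<^sub>R v)
      + s * t * (1 - t) * (norm (u - v))\<^sup>2 \<le> t * (f u + g u) + (1 - t) * (f v + g v)"
    by (simp add: algebra_simps)
qed (rule modulus_pos convex_domain)+

text \<open>Strong convexity on the segment from \<open>x\<close> to \<open>z\<close> has the gain \<open>s * t * (1 - t)\<close>; after division by
\<open>t\<close> the limit \<open>t \<rightarrow> 0\<close> keeps the full constant \<open>s\<close>. The descent and monotonicity estimates for the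
dual iteration use all of it to reach the step size \<open>2 * s / onorm A ^ 2\<close>.\<close>

lemma quadratic_growth:
  assumes x: "x \<in> S" and min: "\<And>z. z \<in> S \<Longrightarrow> f x \<le> f z" and z: "z \<in> S"
  shows "f x + s * (norm (z - x))\<^sup>2 \<le> f z"
proof -
  define w where "w = (norm (z - x))\<^sup>2"
  have "0 \<le> (f z - f x - s * w) + t * (s * w)" if t: "0 < t" "t < 1" for t
  proof -
    have "f x + s * t * (1 - t) * w \<le> t * f z + (1 - t) * f x"
      using strong_convexity[OF z x, of t] min[OF segment_mem[OF z x, of t]] t
      by (simp add: w_def)
    then have "0 \<le> t * ((f z - f x - s * w) + t * (s * w))"
      by (simp add: algebra_simps)
    then show ?thesis using t by (simp add: zero_le_mult_iff)
  qed
  then have "0 \<le> f z - f x - s * w" by (rule nonneg_of_affine_nonneg)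
  then show ?thesis by (simp add: w_def)
qed

end

text \<open>Sequential lower semicontinuity, expressed through the real values on \<open>S\<close>: the conclusion
\<open>l \<in> S\<close> says that the extended-valued function cannot jump to infinity at the limit. In this form the
property passes at once to sums with continuous functions.\<close>

locale closed_strongly_convex_function = strongly_convex_function S f s
  for S :: "'x::banach set" and f s +
  assumes limit_closed:
    "\<lbrakk>\<And>k. u k \<in> S; u \<longlonglongrightarrow> l; (\<lambda>k. f (u k)) \<longlonglongrightarrow> c\<rbrakk> \<Longrightarrow> l \<in> S \<and> f l \<le> c"
begin

lemma add_continuous_convex:
  assumes "convex_on S g" and "continuous_on UNIV g"
  shows "closed_strongly_convex_function S (\<lambda>z. f z + g z) s"
proof (intro closed_strongly_convex_function.intro add_convex assms(1)
    closed_strongly_convex_function_axioms.intro)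
  fix u :: "nat \<Rightarrow> 'x" and l c
  assume u: "\<And>k. u k \<in> S" "u \<longlonglongrightarrow> l" and lim: "(\<lambda>k. f (u k) + g (u k)) \<longlonglongrightarrow> c"
  have "(\<lambda>k. g (u k)) \<longlonglongrightarrow> g l"
    using continuous_on_tendsto_compose[OF assms(2) u(2)] by simp
  from tendsto_diff[OF lim this] have "(\<lambda>k. f (u k)) \<longlonglongrightarrow> c - g l" by simp
  from limit_closed[OF u this] show "l \<in> S \<and> f l + g l \<le> c" by simp
qed

text \<open>The midpoint inequality turns near-optimality of two points into closeness, so a minimizing
sequence is Cauchy. Completeness therefore replaces weak compactness.\<close>

lemma exists_minimizer:
  assumes "S \<noteq> {}" and "bdd_below (f ` S)"
  obtains p where "p \<in> S" "\<And>z. z \<in> S \<Longrightarrow> f p \<le> f z"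
proof -
  define m where "m = Inf (f ` S)"
  have lower: "m \<le> f z" if "z \<in> S" for z
    unfolding m_def using that assms(2) by (simp add: cINF_lower)
  have "\<exists>z\<in>S. f z < m + inverse (real (Suc k))" for k
    using cInf_lessD[of "f ` S" "m + inverse (real (Suc k))"] assms(1)
    unfolding m_def by auto
  then obtain u where u: "\<And>k. u k \<in> S" "\<And>k. f (u k) < m + inverse (real (Suc k))"
    by metis
  have inv0: "(\<lambda>k. inverse (real (Suc k))) \<longlonglongrightarrow> 0"
    by (rule LIMSEQ_inverse_real_of_nat)
  have gap: "s * (norm (u j - u k))\<^sup>2 \<le> 2 * (inverse (real (Suc j)) + inverse (real (Suc k)))" for j k
  proof -
    have "f ((1/2) *\<^sub>R u j + (1 - 1/2) *\<^sub>R u k) + s * (1/2) * (1 - 1/2) * (norm (u j - u k))\<^sup>2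
        \<le> (1/2) * f (u j) + (1 - 1/2) * f (u k)"
      by (rule strong_convexity[OF u(1) u(1)]) auto
    moreover have "m \<le> f ((1/2) *\<^sub>R u j + (1 - 1/2) *\<^sub>R u k)"
      by (rule lower[OF segment_mem[OF u(1) u(1)]]) auto
    ultimately show ?thesis using u(2)[of j] u(2)[of k] by simp
  qed
  have "Cauchy u"
  proof (rule CauchyI)
    fix e :: real assume e: "0 < e"
    have "0 < s * e\<^sup>2 / 4" using e modulus_pos by simp
    then obtain K where K: "inverse (real (Suc K)) < s * e\<^sup>2 / 4"
      using reals_Archimedean by blast
    have "norm (u j - u k) < e" if jk: "K \<le> j" "K \<le> k" for j k
    proof -
      have "inverse (real (Suc j)) \<le> inverse (real (Suc K))"
        "inverse (real (Suc k)) \<le> inverse (real (Suc K))"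
        using jk by (simp_all add: le_imp_inverse_le)
      with gap[of j k] have "s * (norm (u j - u k))\<^sup>2 \<le> 4 * inverse (real (Suc K))"
        by (smt (verit))
      also have "\<dots> < s * e\<^sup>2" using K by simp
      finally have "s * (norm (u j - u k))\<^sup>2 < s * e\<^sup>2" .
      then have "(norm (u j - u k))\<^sup>2 < e\<^sup>2" using modulus_pos by simp
      then show ?thesis using e by (simp add: power2_less_imp_less)
    qed
    then show "\<exists>K. \<forall>j\<ge>K. \<forall>k\<ge>K. norm (u j - u k) < e" by blast
  qed
  then obtain p where p: "u \<longlonglongrightarrow> p" using Cauchy_convergent_iff convergent_def by blast
  have "(\<lambda>k. f (u k)) \<longlonglongrightarrow> m"
  proof (rule tendsto_sandwich[of "\<lambda>_. m" _ _ "\<lambda>k. m + inverse (real (Suc k))"])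
    show "(\<lambda>k. m + inverse (real (Suc k))) \<longlonglongrightarrow> m"
      using tendsto_add[OF tendsto_const inv0, of m] by simp
  qed (use lower u in \<open>auto intro!: always_eventually less_imp_le\<close>)
  from limit_closed[OF u(1) p this] lower show thesis
    using that by (meson order_trans)
qed

text \<open>At a minimizer \<open>p\<close> of the penalized problem the gradient \<open>c *\<^sub>R (A p - y)\<close> of the penalty acts as
a Lagrange multiplier: \<open>p\<close> also minimizes \<open>f\<close> plus the linearized penalty. This is the strong duality
between the penalized primal problem and the regularized dual problem, obtained without conjugate
functions.\<close>

lemma penalty_multiplier:
  fixes A :: "'x \<Rightarrow> 'y::real_inner"
  assumes A: "bounded_linear A" and c: "0 < c" and "S \<noteq> {}"
    and bdd: "bdd_below ((\<lambda>z. f z + c / 2 * (norm (A z - y))\<^sup>2) ` S)"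
  obtains p where "p \<in> S"
    "\<And>z. z \<in> S \<Longrightarrow> f p + c * (norm (A p - y))\<^sup>2 \<le> f z + c * ((A p - y) \<bullet> (A z - y))"
proof -
  interpret A: bounded_linear A by fact
  define g where "g z = c / 2 * (norm (A z - y))\<^sup>2" for z
  have expand: "g (t *\<^sub>R u + (1 - t) *\<^sub>R v)
      = t * g u + (1 - t) * g v - c / 2 * t * (1 - t) * (norm (A u - A v))\<^sup>2" for u v t
  proof -
    have "A (t *\<^sub>R u + (1 - t) *\<^sub>R v) - y = t *\<^sub>R (A u - y) + (1 - t) *\<^sub>R (A v - y)"
      by (simp only: A.add A.scaleR) (simp add: algebra_simps)
    then show ?thesis
      by (simp only: g_def norm_convex_combination_sq) (simp add: field_simps)
  qed
  have convex: "convex_on S g"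
  proof (rule convex_onI[OF _ convex_domain])
    fix t :: real and u v assume t: "0 < t" "t < 1"
    have "0 \<le> c / 2 * t * (1 - t) * (norm (A v - A u))\<^sup>2" using t c by simp
    then show "g ((1 - t) *\<^sub>R u + t *\<^sub>R v) \<le> (1 - t) * g u + t * g v"
      using expand[of t v u] by (simp add: add.commute)
  qed
  have cont: "continuous_on UNIV g"
    unfolding g_def by (intro continuous_intros A.continuous_on)
  interpret P: closed_strongly_convex_function S "\<lambda>z. f z + g z" s
    by (rule add_continuous_convex[OF convex cont])
  obtain p where p: "p \<in> S" and min: "\<And>z. z \<in> S \<Longrightarrow> f p + g p \<le> f z + g z"
    using P.exists_minimizer[OF \<open>S \<noteq> {}\<close>] bdd unfolding g_def by blast
  show thesis
  proof (rule that[OF p])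
    fix z assume z: "z \<in> S"
    define w where "w = (norm (A z - A p))\<^sup>2"
    have "0 \<le> (f z + g z - f p - g p - c / 2 * w) + t * (c / 2 * w)" if t: "0 < t" "t < 1" for t
    proof -
      have "f (t *\<^sub>R z + (1 - t) *\<^sub>R p) \<le> t * f z + (1 - t) * f p"
        using convex_on_domain z p t by (simp add: convex_on_def)
      with min[OF segment_mem[OF z p, of t]] t expand[of t z p]
      have "f p + g p \<le> t * f z + (1 - t) * f p + (t * g z + (1 - t) * g p - c / 2 * t * (1 - t) * w)"
        by (simp add: w_def)
      then have "0 \<le> t * ((f z + g z - f p - g p - c / 2 * w) + t * (c / 2 * w))"
        by (simp add: field_simps)
      then show ?thesis using t by (simp add: zero_le_mult_iff)
    qed
    then have "0 \<le> f z + g z - f p - g p - c / 2 * w" by (rule nonneg_of_affine_nonneg)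
    moreover have "w = (norm (A z - y))\<^sup>2 - 2 * ((A p - y) \<bullet> (A z - y)) + (norm (A p - y))\<^sup>2"
      unfolding w_def power2_norm_eq_inner by (simp add: inner_diff inner_commute)
    ultimately show "f p + c * (norm (A p - y))\<^sup>2 \<le> f z + c * ((A p - y) \<bullet> (A z - y))"
      by (simp add: g_def algebra_simps)
  qed
qed

end

section \<open>Approximate multipliers from a source condition\<close>

text \<open>The threshold for \<open>t\<close> is the point where \<open>M * t powr q\<close> and \<open>c / 2 * t\<^sup>2\<close> are equal: above it the
square dominates, below it the first term is at most its value there.\<close>

lemma powr_minus_square_le:
  fixes t q M c :: real
  assumes t: "0 \<le> t" and q: "0 < q" "q \<le> 1" and M: "0 < M" and c: "0 < c"
  shows "M * t powr q - c / 2 * t\<^sup>2 \<le> M * (2 * M / c) powr (q / (2 - q))"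
proof (cases "t powr (2 - q) \<le> 2 * M / c")
  case True
  have "t powr q = (t powr (2 - q)) powr (q / (2 - q))"
    using q by (simp add: powr_powr)
  also have "\<dots> \<le> (2 * M / c) powr (q / (2 - q))"
    using True q by (intro powr_mono2) auto
  finally have "M * t powr q \<le> M * (2 * M / c) powr (q / (2 - q))" using M by simp
  moreover have "0 \<le> c / 2 * t\<^sup>2" using c by simp
  ultimately show ?thesis by linarith
next
  case False
  have tpos: "0 < t" using False t M c by (cases "t = 0") (auto simp: field_simps)
  have "M \<le> c / 2 * t powr (2 - q)" using False c by (simp add: field_simps)
  then have "M * t powr q \<le> c / 2 * t powr (2 - q) * t powr q"
    by (intro mult_right_mono) auto
  also have "\<dots> = c / 2 * t\<^sup>2" using tpos by (simp add: powr_add[symmetric])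
  finally have "M * t powr q \<le> c / 2 * t\<^sup>2" .
  moreover have "0 \<le> M * (2 * M / c) powr (q / (2 - q))" using M by simp
  ultimately show ?thesis by linarith
qed

text \<open>The source inequality bounds the penalized objective from below up to the error term of
\<open>powr_minus_square_le\<close>. The multiplier \<open>\<mu> = - c *\<^sub>R (A p - y)\<close> is scaled so that
\<open>norm \<mu> ^ 2 / (2 * c)\<close> equals the penalty at \<open>p\<close>. In dual terms, the regularized dual function at
\<open>\<mu>\<close> exceeds \<open>- f\<^sub>0\<close> by at most that error term, even if the dual problem itself
has no solution.\<close>

lemma (in closed_strongly_convex_function) source_multiplier:
  fixes A :: "'x \<Rightarrow> 'y::real_inner"
  assumes A: "bounded_linear A" and c: "0 < c" and "S \<noteq> {}"
    and q: "0 < q" "q \<le> 1" and M: "0 < M"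
    and source: "\<And>z. z \<in> S \<Longrightarrow> f\<^sub>0 \<le> f z + M * norm (A z - y) powr q"
  obtains \<mu> where
    "\<And>z. z \<in> S \<Longrightarrow> f\<^sub>0 + (norm \<mu>)\<^sup>2 / (2 * c)
        \<le> f z - \<mu> \<bullet> (A z - y) + M * (2 * M / c) powr (q / (2 - q))"
proof -
  have penalized: "f\<^sub>0 - M * (2 * M / c) powr (q / (2 - q)) \<le> f z + c / 2 * (norm (A z - y))\<^sup>2"
    if "z \<in> S" for z
    using source[OF that] powr_minus_square_le[OF norm_ge_zero q M c, of "A z - y"] by linarith
  then have "bdd_below ((\<lambda>z. f z + c / 2 * (norm (A z - y))\<^sup>2) ` S)"
    by (intro bdd_belowI2)
  then obtain p where p: "p \<in> S"
    "\<And>z. z \<in> S \<Longrightarrow> f p + c * (norm (A p - y))\<^sup>2 \<le> f z + c * ((A p - y) \<bullet> (A z - y))"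
    using penalty_multiplier[OF A c \<open>S \<noteq> {}\<close>] by blast
  show thesis
  proof (rule that[of "- c *\<^sub>R (A p - y)"])
    fix z assume "z \<in> S"
    have "(norm (- c *\<^sub>R (A p - y)))\<^sup>2 / (2 * c) = c / 2 * (norm (A p - y))\<^sup>2"
      using c by (simp add: power_mult_distrib power2_eq_square)
    moreover have "- c *\<^sub>R (A p - y) \<bullet> (A z - y) = - (c * ((A p - y) \<bullet> (A z - y)))"
      by simp
    ultimately show "f\<^sub>0 + (norm (- c *\<^sub>R (A p - y)))\<^sup>2 / (2 * c)
        \<le> f z - (- c *\<^sub>R (A p - y)) \<bullet> (A z - y) + M * (2 * M / c) powr (q / (2 - q))"
      using p(2)[OF \<open>z \<in> S\<close>] penalized[OF p(1)] by linarith
  qed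
qed

section \<open>Gradient descent on the dual problem\<close>

text \<open>The iteration is gradient descent for the convex function
\<open>d \<mu> = (SUP z\<in>S. \<mu> \<bullet> (A z - b) - f z)\<close>, whose gradient at \<open>lam n\<close> is \<open>A (x n) - b\<close>. It enters
through its values at the iterates (\<open>dual_value\<close>) and through upper bounds \<open>D\<close> at a comparison point
\<open>\<mu>\<close>. The step size condition says that \<open>\<gamma>\<close> times \<open>onorm A ^ 2 / (2 * s)\<close>, a Lipschitz constant of
the gradient, is at most 1.\<close>

locale dual_gradient = strongly_convex_function S f s
  for S :: "'x::real_normed_vector set" and f s +
  fixes A :: "'x \<Rightarrow> 'y::real_inner" and \<gamma> :: real and b :: 'y
    and x :: "nat \<Rightarrow> 'x" and lam :: "nat \<Rightarrow> 'y"
  assumes linear: "linear A"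
    and step_pos: "0 < \<gamma>"
    and step_size: "\<gamma> * (norm (A v))\<^sup>2 \<le> 2 * s * (norm v)\<^sup>2"
    and primal_mem: "x n \<in> S"
    and primal_min: "z \<in> S \<Longrightarrow> f (x n) - lam n \<bullet> (A (x n) - b) \<le> f z - lam n \<bullet> (A z - b)"
    and lam_0: "lam 0 = 0"
    and lam_Suc: "lam (Suc n) = lam n - \<gamma> *\<^sub>R (A (x n) - b)"
begin

definition residual :: "nat \<Rightarrow> 'y" where
  "residual n = A (x n) - b"

definition dual_value :: "nat \<Rightarrow> real" where
  "dual_value n = lam n \<bullet> residual n - f (x n)"

lemma lagrangian_growth:
  assumes z: "z \<in> S"
  shows "s * (norm (z - x n))\<^sup>2 \<le> f z - lam n \<bullet> (A z - b) + dual_value n"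
proof -
  have "convex_on S (\<lambda>z. - (lam n \<bullet> (A z - b)))"
  proof (rule convex_onI[OF _ convex_domain])
    fix t :: real and u v
    have "A ((1 - t) *\<^sub>R u + t *\<^sub>R v) - b = (1 - t) *\<^sub>R (A u - b) + t *\<^sub>R (A v - b)"
      by (simp only: linear_add[OF linear] linear_scale[OF linear]) (simp add: algebra_simps)
    then show "- (lam n \<bullet> (A ((1 - t) *\<^sub>R u + t *\<^sub>R v) - b))
        \<le> (1 - t) * - (lam n \<bullet> (A u - b)) + t * - (lam n \<bullet> (A v - b))"
      by (simp add: inner_add_right)
  qed
  from strongly_convex_function.quadratic_growth[OF add_convex[OF this] primal_mem _ z, of n] primal_min[of _ n]
  show ?thesis by (auto simp: dual_value_def residual_def)
qed

lemma residual_diff: "residual (Suc n) - residual n = A (x (Suc n) - x n)"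
  by (simp add: residual_def linear_diff[OF linear])

text \<open>Adding the growth inequalities of two consecutive Lagrangians gives
\<open>2 * s * norm v ^ 2 \<le> - \<gamma> * (a \<bullet> e)\<close> for the primal step \<open>v\<close>, the residual \<open>a\<close> and its change
\<open>e = A v\<close>. With the step size condition this is cocoercivity of the dual gradient, which makes the
gradient step nonexpansive on residuals.\<close>

lemma residual_antitone: "norm (residual (Suc n)) \<le> norm (residual n)"
proof -
  define v where "v = x (Suc n) - x n"
  define a where "a = residual n"
  define e where "e = A v"
  have r: "residual (Suc n) = a + e" by (simp add: residual_diff[symmetric] a_def v_def e_def)
  have r': "A (x (Suc n)) - b = a + e" "A (x n) - b = a"
    using r by (simp_all add: residual_def a_def)
  have lam: "lam (Suc n) = lam n - \<gamma> *\<^sub>R a" by (simp add: lam_Suc a_def residual_def)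
  have "s * (norm v)\<^sup>2 \<le> f (x (Suc n)) - lam n \<bullet> (a + e) + dual_value n"
    using lagrangian_growth[OF primal_mem, of "Suc n" n] by (simp add: r' v_def)
  moreover have "s * (norm v)\<^sup>2 \<le> f (x n) - lam (Suc n) \<bullet> a + dual_value (Suc n)"
    using lagrangian_growth[OF primal_mem, of n "Suc n"]
    by (simp add: r' v_def norm_minus_commute)
  ultimately have "2 * s * (norm v)\<^sup>2 \<le> - \<gamma> * (a \<bullet> e)"
    by (simp add: dual_value_def r lam a_def[symmetric] inner_simps algebra_simps)
  with step_size[of v] have "\<gamma> * (norm e)\<^sup>2 \<le> \<gamma> * - (a \<bullet> e)" by (simp add: e_def)
  then have "(norm e)\<^sup>2 \<le> - (a \<bullet> e)" using step_pos by (simp only: mult_le_cancel_left_pos)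
  moreover have "(norm (a + e))\<^sup>2 = (norm a)\<^sup>2 + 2 * (a \<bullet> e) + (norm e)\<^sup>2"
    unfolding power2_norm_eq_inner by (simp add: inner_simps inner_commute)
  ultimately have "(norm (a + e))\<^sup>2 \<le> (norm a)\<^sup>2"
    using zero_le_power2[of "norm e"] by linarith
  then show ?thesis by (simp add: r a_def[symmetric])
qed

text \<open>The decrease comes from completing the square: what the residual change costs is paid for by the
quadratic growth of the Lagrangian.\<close>

lemma dual_descent: "dual_value (Suc n) + \<gamma> / 2 * (norm (residual n))\<^sup>2 \<le> dual_value n"
proof -
  define v where "v = x (Suc n) - x n"
  define a where "a = residual n"
  define e where "e = A v"
  have r: "residual (Suc n) = a + e" by (simp add: residual_diff[symmetric] a_def v_def e_def)
  have r': "A (x (Suc n)) - b = a + e"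
    using r by (simp add: residual_def)
  have lam: "lam (Suc n) = lam n - \<gamma> *\<^sub>R a" by (simp add: lam_Suc a_def residual_def)
  have "s * (norm v)\<^sup>2 \<le> f (x (Suc n)) - lam n \<bullet> (a + e) + dual_value n"
    using lagrangian_growth[OF primal_mem, of "Suc n" n] by (simp add: r' v_def)
  then have "dual_value (Suc n) + \<gamma> * (a \<bullet> (a + e)) + s * (norm v)\<^sup>2 \<le> dual_value n"
    by (simp add: dual_value_def[of "Suc n"] r lam inner_diff_left)
  moreover have "\<gamma> / 2 * (norm e)\<^sup>2 \<le> s * (norm v)\<^sup>2" using step_size[of v] by (simp add: e_def)
  moreover have "\<gamma> / 2 * (norm a)\<^sup>2 \<le> \<gamma> * (a \<bullet> (a + e)) + \<gamma> / 2 * (norm e)\<^sup>2"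
  proof -
    have "\<gamma> * (a \<bullet> (a + e)) + \<gamma> / 2 * (norm e)\<^sup>2 - \<gamma> / 2 * (norm a)\<^sup>2 = \<gamma> / 2 * (norm (a + e))\<^sup>2"
      unfolding power2_norm_eq_inner by (simp add: inner_simps inner_commute field_simps)
    moreover have "0 \<le> \<gamma> / 2 * (norm (a + e))\<^sup>2" using step_pos by simp
    ultimately show ?thesis by linarith
  qed
  ultimately show ?thesis by (simp add: a_def)
qed

lemma dual_one_step:
  assumes D: "\<And>z. z \<in> S \<Longrightarrow> - D \<le> f z - \<mu> \<bullet> (A z - b)"
  shows "dual_value (Suc n) - D
    \<le> ((norm (lam n - \<mu>))\<^sup>2 - (norm (lam (Suc n) - \<mu>))\<^sup>2) / (2 * \<gamma>)"
proof -
  define a where "a = residual n"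
  define w where "w = lam n - \<mu>"
  have "dual_value n - D \<le> w \<bullet> a"
    using D[OF primal_mem, of n] by (simp add: dual_value_def residual_def w_def a_def inner_diff_left)
  then have "dual_value (Suc n) - D \<le> w \<bullet> a - \<gamma> / 2 * (norm a)\<^sup>2"
    using dual_descent[of n] by (simp add: a_def)
  moreover have "lam (Suc n) - \<mu> = w - \<gamma> *\<^sub>R a" by (simp add: lam_Suc w_def a_def residual_def)
  moreover have "((norm w)\<^sup>2 - (norm (w - \<gamma> *\<^sub>R a))\<^sup>2) / (2 * \<gamma>) = w \<bullet> a - \<gamma> / 2 * (norm a)\<^sup>2"
    unfolding power2_norm_eq_inner using step_pos
    by (simp add: inner_simps inner_commute field_simps)
  ultimately show ?thesis by (simp add: w_def[symmetric])
qed

text \<open>The energy adds to the usual telescoped estimate for the dual values the weighted residual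
\<open>n * (n + 1) * norm (residual n) ^ 2\<close>. Multiplying the descent in step \<open>n + 1\<close> by \<open>n + 1\<close> frees exactly
\<open>\<gamma> / 2 * (n + 1)\<close> times the squared residual, the increment of the weights \<open>\<gamma> / 4 * n * (n + 1)\<close>; the
monotonicity of the residuals does the rest. The residual index lags one behind the dual index, so
that the weight is positive already for \<open>n = 1\<close>.\<close>

lemma dual_energy:
  assumes D: "\<And>z. z \<in> S \<Longrightarrow> - D \<le> f z - \<mu> \<bullet> (A z - b)"
  shows "real (Suc n) * (dual_value (Suc n) - D) + (norm (lam (Suc n) - \<mu>))\<^sup>2 / (2 * \<gamma>)
      + \<gamma> / 4 * (real n * real (Suc n)) * (norm (residual n))\<^sup>2 \<le> (norm \<mu>)\<^sup>2 / (2 * \<gamma>)"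
proof (induction n)
  case 0
  then show ?case
    using dual_one_step[of D \<mu> 0, OF D] by (simp add: lam_0 diff_divide_distrib)
next
  case (Suc n)
  define k where "k = real (Suc n)"
  define \<rho> where "\<rho> = (norm (residual (Suc n)))\<^sup>2"
  have k: "real (Suc (Suc n)) = k + 1" "real n = k - 1" "1 \<le> k" by (simp_all add: k_def)
  have "k * dual_value (Suc (Suc n)) \<le> k * (dual_value (Suc n) - \<gamma> / 2 * \<rho>)"
    using dual_descent[of "Suc n"] k by (intro mult_left_mono) (auto simp: \<rho>_def)
  moreover have "dual_value (Suc (Suc n)) - D
      \<le> (norm (lam (Suc n) - \<mu>))\<^sup>2 / (2 * \<gamma>) - (norm (lam (Suc (Suc n)) - \<mu>))\<^sup>2 / (2 * \<gamma>)"
    using dual_one_step[of D \<mu> "Suc n", OF D] by (simp add: diff_divide_distrib)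
  moreover have "\<gamma> / 4 * ((k - 1) * k) * \<rho> \<le> \<gamma> / 4 * ((k - 1) * k) * (norm (residual n))\<^sup>2"
    unfolding \<rho>_def using residual_antitone[of n] step_pos k
    by (intro mult_left_mono power_mono) auto
  moreover have "\<gamma> / 4 * (k * (k + 1)) * \<rho> = \<gamma> / 4 * ((k - 1) * k) * \<rho> + k * (\<gamma> / 2 * \<rho>)"
    by (simp add: field_simps)
  ultimately show ?case using Suc.IH
    unfolding k \<rho>_def[symmetric] k_def[symmetric] distrib_right right_diff_distrib mult_1
    by linarith
qed

end

section \<open>Noisy data\<close>

lemma norm_le_of_square_le_sum:
  fixes w :: "'a::real_normed_vector"
  assumes "(norm w)\<^sup>2 \<le> p\<^sup>2 + t\<^sup>2" "0 \<le> p" "0 \<le> t"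
  shows "norm w \<le> p + t"
proof (rule power2_le_imp_le)
  have "p\<^sup>2 + t\<^sup>2 \<le> (p + t)\<^sup>2" using assms(2,3) by (simp add: power2_sum)
  then show "(norm w)\<^sup>2 \<le> (p + t)\<^sup>2" using assms(1) by linarith
qed (use assms in simp)

context dual_gradient
begin

text \<open>The energy estimate has a possibly negative term, the gap between \<open>dual_value (Suc n)\<close> and the
value at \<open>\<mu>\<close>. By weak duality at the feasible point \<open>z\<^sub>0\<close> it is bounded below by the multiplier term
up to \<open>K\<close> and the noise contribution \<open>norm (lam (Suc n) - \<mu>) * \<delta>\<close>. Young's inequality absorbs the
latter at the price \<open>\<gamma> * (k * \<delta>)\<^sup>2\<close>.\<close>

lemma noisy_energy:
  fixes n :: nat and K :: real
  defines "k \<equiv> real (Suc n)"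
  assumes z0: "z\<^sub>0 \<in> S" "A z\<^sub>0 = y" and noise: "norm (b - y) \<le> \<delta>"
    and \<mu>: "\<And>z. z \<in> S \<Longrightarrow>
      f z\<^sub>0 + (norm \<mu>)\<^sup>2 / (2 * (\<gamma> * k)) \<le> f z - \<mu> \<bullet> (A z - y) + K"
  shows "(norm (lam (Suc n) - \<mu>))\<^sup>2 / (4 * \<gamma>) + \<gamma> / 4 * (real n * k) * (norm (residual n))\<^sup>2
      \<le> k * K + \<gamma> * (k * \<delta>)\<^sup>2"
proof -
  define D where "D = K - f z\<^sub>0 - (norm \<mu>)\<^sup>2 / (2 * (\<gamma> * k)) + \<mu> \<bullet> (y - b)"
  define w where "w = lam (Suc n) - \<mu>"
  have k: "0 < k" by (simp add: k_def)
  have "- D \<le> f z - \<mu> \<bullet> (A z - b)" if "z \<in> S" for z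
    using \<mu>[OF that] by (simp add: D_def inner_diff_right)
  from dual_energy[OF this, of n]
  have energy: "k * (dual_value (Suc n) - D) + (norm w)\<^sup>2 / (2 * \<gamma>)
      + \<gamma> / 4 * (real n * k) * (norm (residual n))\<^sup>2 \<le> (norm \<mu>)\<^sup>2 / (2 * \<gamma>)"
    by (simp add: k_def w_def)
  \<comment> \<open>Both data vectors enter only through \<open>w\<close>: the noise terms of the two dual values combine.\<close>
  have "w \<bullet> (b - y) \<le> norm w * \<delta>"
    using norm_cauchy_schwarz[of w "b - y"] mult_left_mono[OF noise norm_ge_zero[of w]] by linarith
  moreover have "lam (Suc n) \<bullet> (y - b) - f z\<^sub>0 \<le> dual_value (Suc n)"
    using primal_min[OF z0(1), of "Suc n"] z0(2) by (simp add: dual_value_def residual_def)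
  ultimately have "(norm \<mu>)\<^sup>2 / (2 * (\<gamma> * k)) - K - norm w * \<delta> \<le> dual_value (Suc n) - D"
    by (simp add: D_def w_def inner_diff)
  then have "k * ((norm \<mu>)\<^sup>2 / (2 * (\<gamma> * k)) - K - norm w * \<delta>) \<le> k * (dual_value (Suc n) - D)"
    using k by (intro mult_left_mono) auto
  moreover have "k * ((norm \<mu>)\<^sup>2 / (2 * (\<gamma> * k)) - K - norm w * \<delta>)
      = (norm \<mu>)\<^sup>2 / (2 * \<gamma>) - k * K - norm w * (k * \<delta>)"
    using k step_pos by (simp add: right_diff_distrib)
  moreover have "norm w * (k * \<delta>) \<le> (norm w)\<^sup>2 / (4 * \<gamma>) + \<gamma> * (k * \<delta>)\<^sup>2"
  proof -
    have "(norm w)\<^sup>2 / (4 * \<gamma>) + \<gamma> * (k * \<delta>)\<^sup>2 - norm w * (k * \<delta>)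
        = (norm w - 2 * \<gamma> * (k * \<delta>))\<^sup>2 / (4 * \<gamma>)"
      using step_pos by (simp add: power2_eq_square field_simps)
    moreover have "0 \<le> (norm w - 2 * \<gamma> * (k * \<delta>))\<^sup>2 / (4 * \<gamma>)" using step_pos by simp
    ultimately show ?thesis by linarith
  qed
  moreover have "(norm w)\<^sup>2 / (2 * \<gamma>) = (norm w)\<^sup>2 / (4 * \<gamma>) + (norm w)\<^sup>2 / (4 * \<gamma>)"
    by (simp add: field_simps)
  ultimately show ?thesis using energy unfolding w_def[symmetric] by linarith
qed

text \<open>The number \<open>e\<close> measures the deterministic error on the scale of the multipliers and \<open>k * \<delta>\<close>
the noise on the same scale; residuals are smaller than multipliers by a factor of order \<open>k\<close>. The
multiplier is recovered from the next one through the gradient step.\<close>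

lemma iterate_bounds:
  fixes n :: nat and K :: real
  defines "k \<equiv> real (Suc n)"
  assumes n: "1 \<le> n"
    and z0: "z\<^sub>0 \<in> S" "A z\<^sub>0 = y" and noise: "norm (b - y) \<le> \<delta>"
    and \<mu>: "\<And>z. z \<in> S \<Longrightarrow>
      f z\<^sub>0 + (norm \<mu>)\<^sup>2 / (2 * (\<gamma> * k)) \<le> f z - \<mu> \<bullet> (A z - y) + K"
    and e: "0 \<le> e" and K: "k * K = \<gamma> * e\<^sup>2 / 8"
  shows "norm (lam n) \<le> \<gamma> * (3 * e + 5 * (k * \<delta>))"
    and "k * norm (A (x n) - y) \<le> e + 4 * (k * \<delta>)"
proof -
  define d where "d = k * \<delta>"
  have k: "1 \<le> k" by (simp add: k_def)
  have "0 \<le> \<delta>" using noise norm_ge_zero order_trans by blast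
  then have d: "0 \<le> d" using k by (simp add: d_def)
  have energy: "(norm (lam (Suc n) - \<mu>))\<^sup>2 / (4 * \<gamma>) + \<gamma> / 4 * (real n * k) * (norm (residual n))\<^sup>2
      \<le> \<gamma> * e\<^sup>2 / 8 + \<gamma> * d\<^sup>2"
    using noisy_energy[OF z0 noise \<mu>[unfolded k_def], folded k_def] by (simp only: K d_def)
  have nonneg: "0 \<le> (norm (lam (Suc n) - \<mu>))\<^sup>2 / (4 * \<gamma>)"
    "0 \<le> \<gamma> / 4 * (real n * k) * (norm (residual n))\<^sup>2"
    using step_pos k by simp_all
  have mu: "norm \<mu> \<le> \<gamma> * e"
  proof (rule power2_le_imp_le)
    have "(norm \<mu>)\<^sup>2 / (2 * (\<gamma> * k)) \<le> K" using \<mu>[OF z0(1)] z0(2) by simp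
    then have "(norm \<mu>)\<^sup>2 \<le> 2 * \<gamma> * (k * K)" using step_pos k by (simp add: field_simps)
    also have "\<dots> = \<gamma>\<^sup>2 * e\<^sup>2 / 4" by (simp add: K power2_eq_square)
    also have "\<dots> \<le> (\<gamma> * e)\<^sup>2" by (simp add: power_mult_distrib)
    finally show "(norm \<mu>)\<^sup>2 \<le> (\<gamma> * e)\<^sup>2" .
  qed (use e step_pos in simp)
  have diff: "norm (lam (Suc n) - \<mu>) \<le> \<gamma> * e + 2 * \<gamma> * d"
  proof (rule norm_le_of_square_le_sum)
    have "(norm (lam (Suc n) - \<mu>))\<^sup>2 / (4 * \<gamma>) \<le> \<gamma> * e\<^sup>2 / 8 + \<gamma> * d\<^sup>2"
      using energy nonneg by linarith
    then have "(norm (lam (Suc n) - \<mu>))\<^sup>2 \<le> \<gamma>\<^sup>2 * e\<^sup>2 / 2 + 4 * \<gamma>\<^sup>2 * d\<^sup>2"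
      using step_pos by (simp add: field_simps power2_eq_square)
    moreover have "0 \<le> \<gamma>\<^sup>2 * e\<^sup>2" by simp
    moreover have "(\<gamma> * e)\<^sup>2 + (2 * \<gamma> * d)\<^sup>2 = \<gamma>\<^sup>2 * e\<^sup>2 + 4 * \<gamma>\<^sup>2 * d\<^sup>2"
      by (simp add: power_mult_distrib)
    ultimately show "(norm (lam (Suc n) - \<mu>))\<^sup>2 \<le> (\<gamma> * e)\<^sup>2 + (2 * \<gamma> * d)\<^sup>2"
      by linarith
  qed (use e d step_pos in simp_all)
  have res: "norm (k *\<^sub>R residual n) \<le> e + 3 * d"
  proof (rule norm_le_of_square_le_sum)
    have "k / 2 \<le> real n" using n by (simp add: k_def)
    then have "\<gamma> / 4 * (k / 2 * k) * (norm (residual n))\<^sup>2 \<le> \<gamma> / 4 * (real n * k) * (norm (residual n))\<^sup>2"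
      using k step_pos by (intro mult_right_mono mult_left_mono) auto
    then have "\<gamma> / 8 * (k\<^sup>2 * (norm (residual n))\<^sup>2) \<le> \<gamma> / 8 * (e\<^sup>2 + 8 * d\<^sup>2)"
      using energy nonneg by (simp add: power2_eq_square algebra_simps)
    then have "k\<^sup>2 * (norm (residual n))\<^sup>2 \<le> e\<^sup>2 + 8 * d\<^sup>2"
      using step_pos by simp
    moreover have "(norm (k *\<^sub>R residual n))\<^sup>2 = k\<^sup>2 * (norm (residual n))\<^sup>2"
      "(3 * d)\<^sup>2 = 9 * d\<^sup>2" "0 \<le> d\<^sup>2"
      by (simp_all add: power_mult_distrib)
    ultimately show "(norm (k *\<^sub>R residual n))\<^sup>2 \<le> e\<^sup>2 + (3 * d)\<^sup>2" by linarith
  qed (use e d in simp_all)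
  have res': "k * norm (residual n) \<le> e + 3 * d" using res k by simp
  have res1: "norm (residual n) \<le> e + 3 * d"
    using res' mult_right_mono[OF k norm_ge_zero[of "residual n"]] by linarith
  have "lam n = \<mu> + (lam (Suc n) - \<mu>) + \<gamma> *\<^sub>R residual n" by (simp add: lam_Suc residual_def)
  then have "norm (lam n) \<le> norm \<mu> + norm (lam (Suc n) - \<mu>) + \<gamma> * norm (residual n)"
    using norm_triangle_ineq[of "\<mu> + (lam (Suc n) - \<mu>)" "\<gamma> *\<^sub>R residual n"]
      norm_triangle_ineq[of \<mu> "lam (Suc n) - \<mu>"] step_pos by simp
  moreover have "\<gamma> * norm (residual n) \<le> \<gamma> * (e + 3 * d)"
    using res1 step_pos by simp
  ultimately show "norm (lam n) \<le> \<gamma> * (3 * e + 5 * (k * \<delta>))"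
    using mu diff unfolding d_def[symmetric] by (simp add: algebra_simps)
  have "A (x n) - y = residual n + (b - y)" by (simp add: residual_def)
  then have "norm (A (x n) - y) = norm (residual n + (b - y))" by (rule arg_cong)
  then have "norm (A (x n) - y) \<le> norm (residual n) + \<delta>"
    using norm_triangle_ineq[of "residual n" "b - y"] noise by linarith
  then have "k * norm (A (x n) - y) \<le> k * norm (residual n) + d"
    using k by (simp add: d_def distrib_left[symmetric])
  then show "k * norm (A (x n) - y) \<le> e + 4 * (k * \<delta>)" using res' by (simp add: d_def)
qed

lemma objective_gap:
  assumes "z\<^sub>0 \<in> S" "A z\<^sub>0 = y"
  shows "f (x n) - f z\<^sub>0 \<le> norm (lam n) * norm (A (x n) - y)"
proof -
  have "f (x n) - f z\<^sub>0 \<le> lam n \<bullet> (A (x n) - y)"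
    using primal_min[OF assms(1), of n] assms(2) by (simp add: inner_diff_right)
  also have "\<dots> \<le> norm (lam n) * norm (A (x n) - y)" by (rule norm_cauchy_schwarz)
  finally show ?thesis .
qed

end

section \<open>Convergence rates\<close>

lemma powr_add_le_twice:
  fixes u v q :: real
  assumes "0 \<le> u" "0 \<le> v" "0 \<le> q" "q \<le> 1"
  shows "(u + v) powr q \<le> 2 * (u powr q + v powr q)"
proof -
  have "(u + v) powr q \<le> (2 * max u v) powr q"
    using assms by (intro powr_mono2) auto
  also have "\<dots> = 2 powr q * max u v powr q" using assms by (simp add: powr_mult)
  also have "\<dots> \<le> 2 * (u powr q + v powr q)"
  proof (rule mult_mono)
    show "2 powr q \<le> (2::real)" using powr_mono[of q 1 "2::real"] assms by simp
    show "max u v powr q \<le> u powr q + v powr q" by (simp add: max_def)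
  qed auto
  finally show ?thesis .
qed

text \<open>The square root is chosen such that \<open>K = M * (2 * M / (\<gamma> * k)) powr (q / (2 - q))\<close> satisfies
\<open>k * K = \<gamma> * e\<^sup>2 / 8\<close> for \<open>e\<close> equal to this root times \<open>k powr ((1 - q) / (2 - q))\<close>, as
\<open>iterate_bounds\<close> requires. The numbers 3 and 5 are the factors in the bound on the multipliers there.\<close>

definition iterate_constant :: "real \<Rightarrow> real \<Rightarrow> real \<Rightarrow> real" where
  "iterate_constant \<gamma> q M = 3 * sqrt (8 * (M * (2 * M / \<gamma>) powr (q / (2 - q))) / \<gamma>) + 5"

definition rate_constant :: "real \<Rightarrow> real \<Rightarrow> real \<Rightarrow> real" where
  "rate_constant \<gamma> q M
    = 4 * \<gamma> * (iterate_constant \<gamma> q M)\<^sup>2 + 2 * M * iterate_constant \<gamma> q M powr q"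

definition rate :: "real \<Rightarrow> nat \<Rightarrow> real \<Rightarrow> real" where
  "rate q n \<delta> = real n powr (- (q / (2 - q))) + \<delta> powr q
     + real n powr ((1 - q) / (2 - q)) * \<delta> + real n * \<delta>\<^sup>2"

text \<open>The choice \<open>c = \<gamma> * (n + 1)\<close> of the penalty matches the term \<open>norm \<mu> ^ 2 / (2 * \<gamma>)\<close> of the energy
estimate. With \<open>a = (1 - q) / (2 - q)\<close> it makes the multipliers of order \<open>n powr a + n * \<delta>\<close> and the
residuals of order \<open>n powr (a - 1) + \<delta>\<close>. Their product bounds the objective gap, and the power \<open>q\<close> of
the latter bounds the remaining term.\<close>

lemma (in dual_gradient) source_rate:
  assumes q: "0 < q" "q \<le> 1" and M: "0 < M" and n: "1 \<le> n"
    and z0: "z\<^sub>0 \<in> S" "A z\<^sub>0 = y" and noise: "norm (b - y) \<le> \<delta>"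
    and multiplier: "\<And>c. 0 < c \<Longrightarrow> \<exists>\<mu>. \<forall>z\<in>S.
      f z\<^sub>0 + (norm \<mu>)\<^sup>2 / (2 * c) \<le> f z - \<mu> \<bullet> (A z - y) + M * (2 * M / c) powr (q / (2 - q))"
  shows "f (x n) - f z\<^sub>0 + M * norm (A (x n) - y) powr q \<le> rate_constant \<gamma> q M * rate q n \<delta>"
proof -
  define a where "a = (1 - q) / (2 - q)"
  define k where "k = real (Suc n)"
  define m where "m = real n"
  define c where "c = M * (2 * M / \<gamma>) powr (q / (2 - q))"
  define G where "G = sqrt (8 * c / \<gamma>)"
  define E where "E = iterate_constant \<gamma> q M"
  define K where "K = M * (2 * M / (\<gamma> * k)) powr (q / (2 - q))"
  have k: "1 \<le> k" "m \<le> k" "k \<le> 2 * m" and m: "1 \<le> m" using n by (simp_all add: k_def m_def)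
  have \<delta>: "0 \<le> \<delta>" using noise norm_ge_zero order_trans by blast
  have a: "0 \<le> a" "a < 1" using q by (simp_all add: a_def)
  have c: "0 \<le> c" using M by (simp add: c_def)
  have G: "0 \<le> G" "\<gamma> * G\<^sup>2 = 8 * c" using c step_pos by (simp_all add: G_def)
  have E: "E = 3 * G + 5" by (simp add: E_def iterate_constant_def G_def c_def)
  have E0: "0 \<le> E" using E G by simp
  have exponents: "1 - q / (2 - q) = 2 * a" "(a - 1) * q = - (q / (2 - q))" "a + (a - 1) = - (q / (2 - q))"
  proof -
    have "a = 1 - 1 / (2 - q)" and "q / (2 - q) = 2 / (2 - q) - 1"
      using q by (simp_all add: a_def field_simps)
    then show "1 - q / (2 - q) = 2 * a" "(a - 1) * q = - (q / (2 - q))" "a + (a - 1) = - (q / (2 - q))"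
      by simp_all
  qed
  have "k * K = c * (k * k powr (- (q / (2 - q))))"
    using k M step_pos by (simp add: K_def c_def powr_divide powr_mult powr_minus field_simps)
  also have "k * k powr (- (q / (2 - q))) = k powr (2 * a)"
    using k by (simp add: powr_mult_base exponents(1)[symmetric])
  also have "k powr (2 * a) = (k powr a)\<^sup>2"
    by (simp add: power2_eq_square powr_add[symmetric])
  finally have K: "k * K = \<gamma> * (G * k powr a)\<^sup>2 / 8"
    using G(2) by (simp add: power_mult_distrib)
  have "0 < \<gamma> * k" using step_pos k by simp
  from multiplier[OF this] obtain \<mu> where
    \<mu>: "\<And>z. z \<in> S \<Longrightarrow> f z\<^sub>0 + (norm \<mu>)\<^sup>2 / (2 * (\<gamma> * k)) \<le> f z - \<mu> \<bullet> (A z - y) + K"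
    unfolding K_def by blast
  have e: "0 \<le> G * k powr a" using G by simp
  note bounds = iterate_bounds[where n = n, folded k_def, OF n z0 noise \<mu> e K]
  have ka: "k powr a \<le> 2 * m powr a"
  proof -
    have "k powr a \<le> (2 * m) powr a" using k a by (intro powr_mono2) auto
    also have "\<dots> = 2 powr a * m powr a" using m by (simp add: powr_mult)
    also have "\<dots> \<le> 2 * m powr a"
      using powr_mono[of a 1 "2::real"] a by (intro mult_right_mono) auto
    finally show ?thesis .
  qed
  have "norm (lam n) \<le> \<gamma> * (3 * (G * k powr a) + 5 * (k * \<delta>))" by (rule bounds(1))
  also have "\<dots> \<le> \<gamma> * (E * (k powr a + k * \<delta>))"
  proof -
    have "0 \<le> G * (k * \<delta>)" "0 \<le> k powr a" using G k \<delta> by simp_all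
    then show ?thesis unfolding E using step_pos by (intro mult_left_mono) (auto simp: algebra_simps)
  qed
  also have "\<dots> \<le> \<gamma> * (E * (2 * (m powr a + m * \<delta>)))"
    using ka mult_right_mono[OF k(3) \<delta>] step_pos E0 by (intro mult_left_mono) auto
  finally have lam: "norm (lam n) \<le> 2 * \<gamma> * E * (m powr a + m * \<delta>)" by (simp add: algebra_simps)
  have "k * norm (A (x n) - y) \<le> G * k powr a + 4 * (k * \<delta>)" by (rule bounds(2))
  also have "\<dots> = k * (G * k powr (a - 1) + 4 * \<delta>)"
    using k by (simp add: powr_diff field_simps)
  finally have "norm (A (x n) - y) \<le> G * k powr (a - 1) + 4 * \<delta>" using k by simp
  also have "\<dots> \<le> G * m powr (a - 1) + 4 * \<delta>"
    using k m a G by (intro add_right_mono mult_left_mono powr_mono2') auto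
  also have "\<dots> \<le> E * (m powr (a - 1) + \<delta>)"
  proof -
    have "0 \<le> G * \<delta>" "0 \<le> G * m powr (a - 1)" "0 \<le> m powr (a - 1)" using G \<delta> by simp_all
    then show ?thesis unfolding E using \<delta> by (simp add: algebra_simps)
  qed
  finally have res: "norm (A (x n) - y) \<le> E * (m powr (a - 1) + \<delta>)" .
  define \<Theta> where "\<Theta> = rate q n \<delta>"
  have \<Theta>: "\<Theta> = m powr (- (q / (2 - q))) + \<delta> powr q + m powr a * \<delta> + m * \<delta>\<^sup>2"
    by (simp add: \<Theta>_def rate_def m_def a_def)
  have nonneg: "0 \<le> m powr (- (q / (2 - q)))" "0 \<le> \<delta> powr q" "0 \<le> m powr a * \<delta>" "0 \<le> m * \<delta>\<^sup>2"
    using \<delta> m by simp_all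
  have "f (x n) - f z\<^sub>0 \<le> norm (lam n) * norm (A (x n) - y)" by (rule objective_gap[OF z0])
  also have "\<dots> \<le> (2 * \<gamma> * E * (m powr a + m * \<delta>)) * (E * (m powr (a - 1) + \<delta>))"
    using lam res step_pos E0 m \<delta> by (intro mult_mono) auto
  also have "\<dots> = 2 * \<gamma> * E\<^sup>2 * ((m powr a + m * \<delta>) * (m powr (a - 1) + \<delta>))"
    by (simp add: power2_eq_square)
  also have "(m powr a + m * \<delta>) * (m powr (a - 1) + \<delta>)
      = m powr a * m powr (a - 1) + m powr a * \<delta> + \<delta> * (m * m powr (a - 1)) + m * \<delta>\<^sup>2"
    by (simp add: power2_eq_square algebra_simps)
  also have "m powr a * m powr (a - 1) = m powr (- (q / (2 - q)))"
    by (simp add: powr_add[symmetric] exponents(3))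
  also have "m * m powr (a - 1) = m powr a" using m by (simp add: powr_mult_base)
  also have "2 * \<gamma> * E\<^sup>2 * (m powr (- (q / (2 - q))) + m powr a * \<delta> + \<delta> * m powr a + m * \<delta>\<^sup>2)
      \<le> 2 * \<gamma> * E\<^sup>2 * (2 * \<Theta>)"
    using nonneg step_pos unfolding \<Theta> by (intro mult_left_mono) auto
  finally have gap: "f (x n) - f z\<^sub>0 \<le> 4 * \<gamma> * E\<^sup>2 * \<Theta>" by simp
  have "norm (A (x n) - y) powr q \<le> (E * (m powr (a - 1) + \<delta>)) powr q"
    using res q by (intro powr_mono2) auto
  also have "\<dots> = E powr q * (m powr (a - 1) + \<delta>) powr q" using E0 \<delta> by (simp add: powr_mult)
  also have "\<dots> \<le> E powr q * (2 * ((m powr (a - 1)) powr q + \<delta> powr q))"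
    using q \<delta> by (intro mult_left_mono powr_add_le_twice) auto
  also have "(m powr (a - 1)) powr q = m powr (- (q / (2 - q)))"
    by (simp add: powr_powr exponents(2))
  also have "E powr q * (2 * (m powr (- (q / (2 - q))) + \<delta> powr q)) \<le> E powr q * (2 * \<Theta>)"
    using nonneg unfolding \<Theta> by (intro mult_left_mono) auto
  finally have "M * norm (A (x n) - y) powr q \<le> M * (E powr q * (2 * \<Theta>))" using M by simp
  with gap show ?thesis
    unfolding rate_constant_def E_def[symmetric] \<Theta>_def[symmetric] by (simp add: algebra_simps)
qed

lemma rate_at_stopping_index:
  assumes q: "0 < q" "q \<le> 1" and \<delta>: "0 < \<delta>" and c1: "0 < c1"
    and n: "c1 * \<delta> powr (q - 2) \<le> real n" "real n \<le> c2 * \<delta> powr (q - 2)"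
  shows "rate q n \<delta> \<le> (c1 powr (- (q / (2 - q))) + 1 + c2 powr ((1 - q) / (2 - q)) + c2) * \<delta> powr q"
proof -
  have pos: "0 < c1 * \<delta> powr (q - 2)" using c1 \<delta> by simp
  then have n0: "0 < real n" using n by linarith
  then have "0 < c2 * \<delta> powr (q - 2)" using n by linarith
  then have c2: "0 < c2" by (simp add: zero_less_mult_iff)
  have "real n powr (- (q / (2 - q))) \<le> (c1 * \<delta> powr (q - 2)) powr (- (q / (2 - q)))"
    using n pos q by (intro powr_mono2') auto
  also have "\<dots> = c1 powr (- (q / (2 - q))) * \<delta> powr ((q - 2) * (- (q / (2 - q))))"
    using c1 by (simp add: powr_mult powr_powr)
  also have "(q - 2) * (- (q / (2 - q))) = q" using q by (simp add: field_simps)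
  finally have 1: "real n powr (- (q / (2 - q))) \<le> c1 powr (- (q / (2 - q))) * \<delta> powr q" .
  have "real n powr ((1 - q) / (2 - q)) \<le> (c2 * \<delta> powr (q - 2)) powr ((1 - q) / (2 - q))"
    using n q by (intro powr_mono2) auto
  also have "\<dots> = c2 powr ((1 - q) / (2 - q)) * \<delta> powr ((q - 2) * ((1 - q) / (2 - q)))"
    using c2 by (simp add: powr_mult powr_powr)
  also have "(q - 2) * ((1 - q) / (2 - q)) = q - 1" using q by (simp add: field_simps)
  finally have "real n powr ((1 - q) / (2 - q)) * \<delta> \<le> c2 powr ((1 - q) / (2 - q)) * \<delta> powr (q - 1) * \<delta>"
    using \<delta> by (intro mult_right_mono) auto
  also have "\<dots> = c2 powr ((1 - q) / (2 - q)) * \<delta> powr q"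
    using \<delta> by (simp add: powr_diff)
  finally have 2: "real n powr ((1 - q) / (2 - q)) * \<delta> \<le> c2 powr ((1 - q) / (2 - q)) * \<delta> powr q" .
  have "real n * \<delta>\<^sup>2 \<le> c2 * \<delta> powr (q - 2) * \<delta>\<^sup>2"
    using n by (intro mult_right_mono) auto
  also have "\<dots> = c2 * \<delta> powr q" using \<delta> by (simp add: powr_diff)
  finally have 3: "real n * \<delta>\<^sup>2 \<le> c2 * \<delta> powr q" .
  from 1 2 3 show ?thesis by (simp add: rate_def algebra_simps)
qed

section \<open>Extended-valued functions\<close>

lemma real_of_strongly_convex:
  assumes R: "\<And>x. R x \<noteq> -\<infinity>" and s: "0 < s" and sc: "strongly_convex_with s R"
  shows "strongly_convex_function (effective_domain R) (\<lambda>z. real_of_ereal (R z)) s"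
proof -
  have *: "t *\<^sub>R u + (1 - t) *\<^sub>R v \<in> effective_domain R \<and>
      real_of_ereal (R (t *\<^sub>R u + (1 - t) *\<^sub>R v)) + s * t * (1 - t) * (norm (u - v))\<^sup>2
        \<le> t * real_of_ereal (R u) + (1 - t) * real_of_ereal (R v)"
    if u: "u \<in> effective_domain R" and v: "v \<in> effective_domain R" and t: "0 \<le> t" "t \<le> 1" for u v t
  proof -
    obtain a where a: "R u = ereal a" using effective_domainE[OF R u] by blast
    obtain b where b: "R v = ereal b" using effective_domainE[OF R v] by blast
    obtain c where "R (t *\<^sub>R u + (1 - t) *\<^sub>R v) = ereal c"
      "c + s * t * (1 - t) * (norm (u - v))\<^sup>2 \<le> t * a + (1 - t) * b"
      using strongly_convex_with_realD[OF R sc a b, of t] t by auto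
    then show ?thesis by (simp add: a b effective_domain_def)
  qed
  show ?thesis
  proof
    show "convex (effective_domain R)"
      unfolding convex_alt using * by (auto simp: add.commute)
  qed (use s * in auto)
qed

text \<open>If the values along a convergent sequence tend to \<open>c\<close>, then lower semicontinuity bounds the value
at the limit by \<open>c\<close>; in particular that value is finite. The punctured \<open>Liminf\<close> suffices since the
centre itself satisfies the strict inequality.\<close>

lemma real_of_closed_strongly_convex:
  fixes R :: "'x::banach \<Rightarrow> ereal"
  assumes R: "\<And>x. R x \<noteq> -\<infinity>" and s: "0 < s" and sc: "strongly_convex_with s R"
    and lsc: "lower_semicontinuous R"
  shows "closed_strongly_convex_function (effective_domain R) (\<lambda>z. real_of_ereal (R z)) s"
proof (intro closed_strongly_convex_function.intro real_of_strongly_convex[OF R s sc]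
    closed_strongly_convex_function_axioms.intro)
  fix u :: "nat \<Rightarrow> 'x" and l c
  assume u: "\<And>k. u k \<in> effective_domain R" "u \<longlonglongrightarrow> l"
    and lim: "(\<lambda>k. real_of_ereal (R (u k))) \<longlonglongrightarrow> c"
  have real: "ereal (real_of_ereal (R (u k))) = R (u k)" for k
    using effective_domainE[OF R u(1)[of k]] by (metis real_of_ereal.simps(1))
  have lim': "(\<lambda>k. R (u k)) \<longlonglongrightarrow> ereal c"
    using tendsto_ereal[OF lim] by (simp only: real)
  have "R l \<le> ereal c"
  proof (rule ccontr)
    assume "\<not> R l \<le> ereal c"
    then obtain d where d: "ereal c < d" "d < R l" using dense not_le by metis
    have "\<forall>\<^sub>F z in at l. d < R z"
      using lsc d(2) unfolding lower_semicontinuous_def le_Liminf_iff by blast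
    then have "\<forall>\<^sub>F z in nhds l. d < R z" using d(2) by (simp add: eventually_nhds_conv_at)
    then have "\<forall>\<^sub>F k in sequentially. d < R (u k)" using u(2) unfolding filterlim_iff by blast
    then have "\<forall>\<^sub>F k in sequentially. d \<le> R (u k)" by eventually_elim simp
    from tendsto_lowerbound[OF lim' this] d(1) show False by simp
  qed
  then show "l \<in> effective_domain R \<and> real_of_ereal (R l) \<le> c"
    using R[of l] by (cases "R l") (auto simp: effective_domain_def)
qed

text \<open>If the modulus is finite, it is itself an admissible constant. If it is infinite, the domain is a
single point and the quotient defining the Lipschitz constant vanishes, so that \<open>\<gamma>\<close> is unrestricted;
a constant large enough for \<open>\<gamma>\<close> is then admissible.\<close>

lemma admissible_step_size:
  fixes A :: "'x::real_normed_vector \<Rightarrow> 'y::real_normed_vector"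
  assumes A: "bounded_linear A" and R: "\<And>x. R x \<noteq> -\<infinity>" and sc: "strongly_convex R"
    and \<gamma>: "0 < \<gamma>" "ereal \<gamma> \<le> 1 / (ereal ((onorm A)\<^sup>2) / (2 * convexity_modulus R))"
  obtains s where "0 < s" "strongly_convex_with s R" "\<And>v. \<gamma> * (norm (A v))\<^sup>2 \<le> 2 * s * (norm v)\<^sup>2"
proof -
  have "\<exists>s>0. strongly_convex_with s R \<and> \<gamma> * (onorm A)\<^sup>2 \<le> 2 * s"
  proof (cases "convexity_modulus R")
    case (real m)
    note m = convexity_modulus_attained[OF R sc real]
    have "\<gamma> * (onorm A)\<^sup>2 \<le> 2 * m"
    proof (cases "onorm A = 0")
      case False
      then have "0 < (onorm A)\<^sup>2" by simp
      then show ?thesis using \<gamma>(2) m(1) by (simp add: real one_ereal_def field_simps)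
    qed (use m in simp)
    with m show ?thesis by blast
  next
    case PInf
    define s where "s = \<gamma> * (onorm A)\<^sup>2 / 2 + 1"
    have "0 < s" using \<gamma>(1) by (simp add: s_def add_nonneg_pos)
    moreover have "strongly_convex_with s R"
      unfolding strongly_convex_with_def
    proof (intro ballI)
      fix u v and t :: real
      assume u: "u \<in> effective_domain R" and v: "v \<in> effective_domain R" and "t \<in> {0..1}"
      obtain a where a: "R u = ereal a" using effective_domainE[OF R u] by blast
      have "v = u" using convexity_modulus_infinite[OF R PInf v u] .
      then show "R (t *\<^sub>R u + (1 - t) *\<^sub>R v) + ereal (s * t * (1 - t) * (norm (u - v))\<^sup>2)
          \<le> ereal t * R u + ereal (1 - t) * R v"
        using a by (simp add: scaleR_left_distrib[symmetric] distrib_right[symmetric])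
    qed
    moreover have "\<gamma> * (onorm A)\<^sup>2 \<le> 2 * s" by (simp add: s_def)
    ultimately show ?thesis by blast
  next
    case MInf
    obtain s where "0 < s" "strongly_convex_with s R" using sc by (auto simp: strongly_convex_def)
    then have "ereal s \<le> convexity_modulus R"
      unfolding convexity_modulus_def by (intro Sup_upper) auto
    then show ?thesis by (simp add: MInf)
  qed
  then obtain s where s: "0 < s" "strongly_convex_with s R" "\<gamma> * (onorm A)\<^sup>2 \<le> 2 * s" by blast
  have "\<gamma> * (norm (A v))\<^sup>2 \<le> 2 * s * (norm v)\<^sup>2" for v
  proof -
    have "\<gamma> * (norm (A v))\<^sup>2 \<le> \<gamma> * (onorm A * norm v)\<^sup>2"
      using onorm[OF A, of v] \<gamma>(1) by (intro mult_left_mono power_mono) auto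
    also have "\<dots> = \<gamma> * (onorm A)\<^sup>2 * (norm v)\<^sup>2" by (simp add: power_mult_distrib)
    also have "\<dots> \<le> 2 * s * (norm v)\<^sup>2" using s(3) by (intro mult_right_mono) auto
    finally show ?thesis .
  qed
  with s that show thesis by blast
qed

lemma iterates_dual_gradient:
  fixes A :: "'x::real_normed_vector \<Rightarrow> 'y::real_inner"
  assumes A: "linear A" and R: "\<And>x. R x \<noteq> -\<infinity>" and ne: "effective_domain R \<noteq> {}"
    and s: "0 < s" "strongly_convex_with s R"
    and \<gamma>: "0 < \<gamma>" "\<And>v. \<gamma> * (norm (A v))\<^sup>2 \<le> 2 * s * (norm v)\<^sup>2"
    and it: "dual_gradient_iterates R A \<gamma> b x lam"
  shows "dual_gradient (effective_domain R) (\<lambda>z. real_of_ereal (R z)) s A \<gamma> b x lam"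
proof -
  have min: "R (x n) - ereal (lam n \<bullet> (A (x n) - b)) \<le> R z - ereal (lam n \<bullet> (A z - b))" for n z
    using it unfolding dual_gradient_iterates_def is_arg_min_def by (meson not_le)
  have mem: "x n \<in> effective_domain R" for n
  proof -
    obtain z where z: "z \<in> effective_domain R" using ne by blast
    then obtain a where "R z = ereal a" using effective_domainE[OF R z] by blast
    with min[of n z] show ?thesis by (cases "R (x n)") (auto simp: effective_domain_def)
  qed
  have "real_of_ereal (R (x n)) - lam n \<bullet> (A (x n) - b) \<le> real_of_ereal (R z) - lam n \<bullet> (A z - b)"
    if z: "z \<in> effective_domain R" for n z
  proof -
    obtain a where "R z = ereal a" using effective_domainE[OF R z] by blast
    moreover obtain c where "R (x n) = ereal c" using effective_domainE[OF R mem] by blast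
    ultimately show ?thesis using min[of n z] by simp
  qed
  note primal = mem this
  interpret strongly_convex_function "effective_domain R" "\<lambda>z. real_of_ereal (R z)" s
    by (rule real_of_strongly_convex[OF R s])
  show ?thesis
  proof
    show "lam 0 = 0" "\<And>n. lam (Suc n) = lam n - \<gamma> *\<^sub>R (A (x n) - b)"
      using it by (simp_all add: dual_gradient_iterates_def)
  qed (use linear_add[OF A] linear_scale[OF A] \<gamma> primal in blast)+
qed

theorem theorem3p4:
  fixes A :: "'x::banach \<Rightarrow> 'y::{real_inner,complete_space}"
    and R :: "'x \<Rightarrow> ereal"
    and \<sigma> L :: ereal
    and y :: 'y
    and xdag :: 'x
    and \<gamma> q M :: real
    and Edag :: "'x \<Rightarrow> real"
  assumes "bounded_linear A"
    and "\<forall>x. R x \<noteq> -\<infinity>"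
    and "effective_domain R \<noteq> {}"
    and "lower_semicontinuous R"
    and "strongly_convex R"
    and "\<sigma> = convexity_modulus R"
    and "\<exists>x\<in>effective_domain R. A x = y"
    and "is_arg_min R (\<lambda>x. A x = y) xdag"
    and "L = ereal ((onorm A)\<^sup>2) / (2 * \<sigma>)"
    and "0 < \<gamma>"
    and "ereal \<gamma> \<le> 1 / L"
    and "\<forall>x\<in>effective_domain R. 0 \<le> Edag x"
    and "Edag xdag = 0"
    and "0 < q" and "q \<le> 1" and "0 < M"
    and "\<forall>x\<in>effective_domain R.
           ereal (Edag x) \<le> R x - R xdag + ereal (M * norm (A x - y) powr q)"
  shows
    "(\<exists>C>0. \<forall>\<delta>>0. \<forall>yd x lam.
        norm (yd - y) \<le> \<delta> \<longrightarrow> dual_gradient_iterates R A \<gamma> yd x lam \<longrightarrow>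
        (\<forall>n\<ge>1. Edag (x n)
           \<le> C * (real n powr (- (q / (2 - q))) + \<delta> powr q
                  + real n powr ((1 - q) / (2 - q)) * \<delta> + real n * \<delta>\<^sup>2)))
     \<and>
     (\<forall>N :: real \<Rightarrow> nat.
        (\<exists>c1>0. \<exists>c2>0. \<forall>\<^sub>F \<delta> in at_right 0.
           c1 * \<delta> powr (q - 2) \<le> real (N \<delta>) \<and> real (N \<delta>) \<le> c2 * \<delta> powr (q - 2)) \<longrightarrow>
        (\<exists>K>0. \<forall>\<^sub>F \<delta> in at_right 0. \<forall>yd x lam.
           norm (yd - y) \<le> \<delta> \<longrightarrow> dual_gradient_iterates R A \<gamma> yd x lam \<longrightarrow>
           Edag (x (N \<delta>)) \<le> K * \<delta> powr q))"
proof -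
  note R = assms(2)[rule_format]
  define f where "f z = real_of_ereal (R z)" for z
  define S where "S = effective_domain R"
  have real: "R z = ereal (f z)" if "z \<in> S" for z
    using effective_domainE[OF R that[unfolded S_def]] unfolding f_def
    by (metis real_of_ereal.simps(1))
  obtain s where s: "0 < s" "strongly_convex_with s R" "\<And>v. \<gamma> * (norm (A v))\<^sup>2 \<le> 2 * s * (norm v)\<^sup>2"
    using admissible_step_size[OF assms(1) R assms(5) assms(10)] assms(6,9,11) by metis
  interpret f: closed_strongly_convex_function S f s
    unfolding S_def f_def[abs_def] by (rule real_of_closed_strongly_convex[OF R s(1,2) assms(4)])
  have xdag: "xdag \<in> S" "A xdag = y"
  proof -
    obtain z where z: "R z < \<infinity>" "A z = y" using assms(7) by (auto simp: effective_domain_def)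
    with assms(8) have "R xdag \<le> R z" by (simp add: is_arg_min_def not_less)
    then have "R xdag < \<infinity>" using z(1) by (rule le_less_trans)
    then show "xdag \<in> S" by (simp add: S_def effective_domain_def)
    show "A xdag = y" using assms(8) by (simp add: is_arg_min_def)
  qed
  have source: "Edag z \<le> f z - f xdag + M * norm (A z - y) powr q" if "z \<in> S" for z
    using assms(17)[rule_format, of z] that xdag real by (simp add: S_def[symmetric])
  have multiplier: "\<exists>\<mu>. \<forall>z\<in>S. f xdag + (norm \<mu>)\<^sup>2 / (2 * c)
      \<le> f z - \<mu> \<bullet> (A z - y) + M * (2 * M / c) powr (q / (2 - q))" if "0 < c" for c
  proof -
    have lower: "f xdag \<le> f z + M * norm (A z - y) powr q" if "z \<in> S" for z
      using source[OF that] assms(12) that by (force simp: S_def)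
    have "S \<noteq> {}" using xdag(1) by blast
    from f.source_multiplier[OF assms(1) that this assms(14,15,16) lower]
    obtain \<mu> where "\<And>z. z \<in> S \<Longrightarrow> f xdag + (norm \<mu>)\<^sup>2 / (2 * c)
      \<le> f z - \<mu> \<bullet> (A z - y) + M * (2 * M / c) powr (q / (2 - q))" by metis
    then show ?thesis by (intro exI[of _ \<mu>] ballI)
  qed
  have bound: "Edag (x n) \<le> rate_constant \<gamma> q M * rate q n \<delta>"
    if "norm (yd - y) \<le> \<delta>" "dual_gradient_iterates R A \<gamma> yd x lam" "1 \<le> n" for \<delta> yd x lam n
  proof -
    interpret dual_gradient S f s A \<gamma> yd x lam
      unfolding S_def f_def[abs_def]
      by (rule iterates_dual_gradient[OF bounded_linear.linear[OF assms(1)] R assms(3) s(1,2) assms(10) s(3) that(2)])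
    show ?thesis
      using source_rate[OF assms(14,15,16) that(3) xdag that(1) multiplier] source[OF primal_mem, of n]
      by linarith
  qed
  have "1 \<le> iterate_constant \<gamma> q M"
    using assms(10,16) by (simp add: iterate_constant_def)
  then have C: "0 < rate_constant \<gamma> q M"
    unfolding rate_constant_def using assms(10,16) by (intro add_pos_pos) auto
  show ?thesis
  proof (intro conjI allI impI)
    show "\<exists>C>0. \<forall>\<delta>>0. \<forall>yd x lam.
        norm (yd - y) \<le> \<delta> \<longrightarrow> dual_gradient_iterates R A \<gamma> yd x lam \<longrightarrow>
        (\<forall>n\<ge>1. Edag (x n)
           \<le> C * (real n powr (- (q / (2 - q))) + \<delta> powr q
                  + real n powr ((1 - q) / (2 - q)) * \<delta> + real n * \<delta>\<^sup>2))"
      using C bound unfolding rate_def by blast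
  next
    fix N :: "real \<Rightarrow> nat"
    assume "\<exists>c1>0. \<exists>c2>0. \<forall>\<^sub>F \<delta> in at_right 0.
        c1 * \<delta> powr (q - 2) \<le> real (N \<delta>) \<and> real (N \<delta>) \<le> c2 * \<delta> powr (q - 2)"
    then obtain c1 c2 where c: "0 < c1" "0 < c2" and N: "\<forall>\<^sub>F \<delta> in at_right 0.
        c1 * \<delta> powr (q - 2) \<le> real (N \<delta>) \<and> real (N \<delta>) \<le> c2 * \<delta> powr (q - 2)" by blast
    define B where "B = c1 powr (- (q / (2 - q))) + 1 + c2 powr ((1 - q) / (2 - q)) + c2"
    have B: "0 < B" using c by (simp add: B_def add_pos_pos)
    show "\<exists>K>0. \<forall>\<^sub>F \<delta> in at_right 0. \<forall>yd x lam.
        norm (yd - y) \<le> \<delta> \<longrightarrow> dual_gradient_iterates R A \<gamma> yd x lam \<longrightarrow>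
        Edag (x (N \<delta>)) \<le> K * \<delta> powr q"
    proof (intro exI conjI)
      show "0 < rate_constant \<gamma> q M * B" using C B by simp
      show "\<forall>\<^sub>F \<delta> in at_right 0. \<forall>yd x lam.
          norm (yd - y) \<le> \<delta> \<longrightarrow> dual_gradient_iterates R A \<gamma> yd x lam \<longrightarrow>
          Edag (x (N \<delta>)) \<le> rate_constant \<gamma> q M * B * \<delta> powr q"
        using N eventually_at_right_less
      proof eventually_elim
        case (elim \<delta>)
        have "0 < c1 * \<delta> powr (q - 2)" using c elim by simp
        then have "1 \<le> N \<delta>" using elim by (cases "N \<delta>") auto
        moreover have "rate_constant \<gamma> q M * rate q (N \<delta>) \<delta> \<le> rate_constant \<gamma> q M * (B * \<delta> powr q)"
          unfolding B_def using C elim c assms(14,15)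
          by (intro mult_left_mono rate_at_stopping_index) auto
        ultimately show ?case using bound[of _ \<delta> _ _ "N \<delta>"] by (force simp: mult.assoc)
      qed
    qed
  qed
qed

end
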